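(* Let $n\geq 6$ and let $Y_n$ be the prism graph. Then $\psi_E(Y_n)=3$.
   Context: All graphs are simple, connected and undirected. The prism graph $Y_n$ is the Cartesian product $C_n\square P_2$ of the cycle of order $n$ and the path of order $2$. For a graph $G$, the edge distance $d_E(f,g)$ between edges $f,g\in E(G)$ is the distance between $f$ and $g$ as vertices of the line graph $L(G)$. Two edges $f,g$ are said to edge doubly resolve edges $f_1,f_2$ if $d_E(f_1,f)-d_E(f_1,g)\neq d_E(f_2,f)-d_E(f_2,g)$. A set $D_E\subseteq E(G)$ is an edge version of doubly resolving set of $G$ if every pair of distinct edges $e\neq f$ of $G$ is edge doubly resolved by some two edges of $D_E$. $\psi_E(G)$ denotes the minimum cardinality of an edge version of doubly resolving set of $G$. *)

theory Defs
  imports Main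
begin

record 'a graph =
  verts :: "'a set"
  edges :: "'a set set"

definition simple_graph :: "'a graph \<Rightarrow> bool" where
  "simple_graph G \<longleftrightarrow> (\<forall>e \<in> edges G. e \<subseteq> verts G \<and> card e = 2)"

definition walk :: "'a graph \<Rightarrow> 'a \<Rightarrow> 'a list \<Rightarrow> 'a \<Rightarrow> bool" where
  "walk G u p v \<longleftrightarrow> p \<noteq> [] \<and> hd p = u \<and> last p = v \<and> set p \<subseteq> verts G \<and>
     successively (\<lambda>x y. {x, y} \<in> edges G) p"

definition connected_graph :: "'a graph \<Rightarrow> bool" where
  "connected_graph G \<longleftrightarrow> verts G \<noteq> {} \<and> (\<forall>u \<in> verts G. \<forall>v \<in> verts G. \<exists>p. walk G u p v)"

text \<open>A walk is given by its list of vertices, so a walk with \<open>k\<close> steps has \<open>k + 1\<close> entries.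
  The value is meaningful only when \<open>u\<close> and \<open>v\<close> are joined by a walk.\<close>

definition graph_dist :: "'a graph \<Rightarrow> 'a \<Rightarrow> 'a \<Rightarrow> nat" where
  "graph_dist G u v = (LEAST k. \<exists>p. walk G u p v \<and> length p = Suc k)"

definition line_graph :: "'a graph \<Rightarrow> 'a set graph" where
  "line_graph G =
     \<lparr>verts = edges G,
      edges = {{e, f} | e f. e \<in> edges G \<and> f \<in> edges G \<and> e \<noteq> f \<and> e \<inter> f \<noteq> {}}\<rparr>"

definition edge_dist :: "'a graph \<Rightarrow> 'a set \<Rightarrow> 'a set \<Rightarrow> nat" where
  "edge_dist G f g = graph_dist (line_graph G) f g"

text \<open>The differences may be negative, hence the passage to the integers.\<close>

definition edge_doubly_resolve ::
    "'a graph \<Rightarrow> 'a set \<Rightarrow> 'a set \<Rightarrow> 'a set \<Rightarrow> 'a set \<Rightarrow> bool" where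
  "edge_doubly_resolve G f g f1 f2 \<longleftrightarrow>
     int (edge_dist G f1 f) - int (edge_dist G f1 g) \<noteq>
     int (edge_dist G f2 f) - int (edge_dist G f2 g)"

definition edge_doubly_resolving_set :: "'a graph \<Rightarrow> 'a set set \<Rightarrow> bool" where
  "edge_doubly_resolving_set G D \<longleftrightarrow> D \<subseteq> edges G \<and>
     (\<forall>e \<in> edges G. \<forall>f \<in> edges G. e \<noteq> f \<longrightarrow>
        (\<exists>x \<in> D. \<exists>y \<in> D. edge_doubly_resolve G x y e f))"

text \<open>For a finite connected graph the whole edge set is an edge doubly resolving set, so the
  minimum exists; \<open>finite D\<close> excludes infinite sets, whose \<open>card\<close> is \<open>0\<close> by convention.\<close>

definition psi_E :: "'a graph \<Rightarrow> nat" where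
  "psi_E G = (LEAST k. \<exists>D. edge_doubly_resolving_set G D \<and> finite D \<and> card D = k)"

text \<open>A cycle in the usual sense for \<open>n \<ge> 3\<close>.\<close>

definition cycle_graph :: "nat \<Rightarrow> nat graph" where
  "cycle_graph n = \<lparr>verts = {..<n}, edges = {{i, Suc i mod n} | i. i < n}\<rparr>"

definition path_graph :: "nat \<Rightarrow> nat graph" where
  "path_graph n = \<lparr>verts = {..<n}, edges = {{i, Suc i} | i. Suc i < n}\<rparr>"

definition cartesian_product :: "'a graph \<Rightarrow> 'b graph \<Rightarrow> ('a \<times> 'b) graph" where
  "cartesian_product G H =
     \<lparr>verts = verts G \<times> verts H,
      edges = {{(u, x), (v, x)} | u v x. {u, v} \<in> edges G \<and> x \<in> verts H} \<union>
              {{(u, x), (u, y)} | u x y. u \<in> verts G \<and> {x, y} \<in> edges H}\<rparr>"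

definition prism :: "nat \<Rightarrow> (nat \<times> nat) graph" where
  "prism n = cartesian_product (cycle_graph n) (path_graph 2)"

lemma simple_cycle_graph:
  assumes "n \<ge> 3"
  shows "simple_graph (cycle_graph n)"
proof -
  have "card {i, Suc i mod n} = 2" "{i, Suc i mod n} \<subseteq> {..<n}" if "i < n" for i
    using that assms by (cases "Suc i = n"; auto simp: card_insert_if)+
  then show ?thesis
    unfolding simple_graph_def cycle_graph_def by auto
qed

lemma simple_path_graph: "simple_graph (path_graph n)"
  unfolding simple_graph_def path_graph_def by auto

lemma simple_cartesian_product:
  assumes "simple_graph G" "simple_graph H"
  shows "simple_graph (cartesian_product G H)"
proof -
  have "u \<in> verts G \<and> v \<in> verts G \<and> u \<noteq> v" if "{u, v} \<in> edges G" for u v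
    using assms(1) that unfolding simple_graph_def by (cases "u = v") fastforce+
  moreover have "x \<in> verts H \<and> y \<in> verts H \<and> x \<noteq> y" if "{x, y} \<in> edges H" for x y
    using assms(2) that unfolding simple_graph_def by (cases "x = y") fastforce+
  ultimately show ?thesis
    unfolding simple_graph_def cartesian_product_def by (auto simp: card_insert_if)
qed

lemma simple_prism: "n \<ge> 3 \<Longrightarrow> simple_graph (prism n)"
  unfolding prism_def
  by (intro simple_cartesian_product simple_cycle_graph simple_path_graph)

lemma walk_append:
  assumes "walk G u p v" "walk G v q w"
  shows "walk G u (p @ tl q) w"
proof (cases "tl q = []")
  case True
  with assms have "q = [v]" "v = w"
    unfolding walk_def by (cases q; auto)+
  with assms show ?thesis by simp
next
  case False
  with assms obtain q' where "q = v # q'" "q' \<noteq> []"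
    unfolding walk_def by (cases q; auto)
  with assms show ?thesis
    unfolding walk_def by (auto simp: successively_append_iff successively_Cons)
qed

lemma walk_rev:
  assumes "walk G u p v"
  shows "walk G v (rev p) u"
  using assms unfolding walk_def by (auto simp: hd_rev last_rev insert_commute)

lemma walk_edge:
  assumes "simple_graph G" "{u, v} \<in> edges G"
  shows "walk G u [u, v] v"
  using assms unfolding walk_def simple_graph_def by auto

lemma connected_prism:
  assumes "n \<ge> 3"
  shows "connected_graph (prism n)"
proof -
  note simple = simple_prism[OF assms]
  have down: "\<exists>p. walk (prism n) (0, 0) p (i, 0)" if "i < n" for i
    using that
  proof (induction i)
    case 0
    then have "walk (prism n) (0, 0) [(0, 0)] (0, 0)"
      by (simp add: walk_def prism_def cartesian_product_def cycle_graph_def path_graph_def)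
    then show ?case by blast
  next
    case (Suc i)
    then have "{i, Suc i} \<in> edges (cycle_graph n)"
      unfolding cycle_graph_def by (force intro: exI[of _ i])
    moreover have "0 \<in> verts (path_graph 2)"
      by (simp add: path_graph_def)
    ultimately have "{(i, 0), (Suc i, 0)} \<in> edges (prism n)"
      unfolding prism_def cartesian_product_def by auto
    from walk_edge[OF simple this] Suc show ?case
      by (meson Suc_lessD walk_append)
  qed
  have base: "\<exists>p. walk (prism n) (0, 0) p v" if mem: "v \<in> verts (prism n)" for v
  proof -
    obtain i b where v: "v = (i, b)" "i < n" "b < 2"
      using mem by (auto simp: prism_def cartesian_product_def cycle_graph_def path_graph_def)
    show ?thesis
    proof (cases "b = 0")
      case True
      with v down show ?thesis by simp
    next
      case False
      with v have "b = Suc 0" by simp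
      have "i \<in> verts (cycle_graph n)" "{0, Suc 0} \<in> edges (path_graph 2)"
        using v by (auto simp: cycle_graph_def path_graph_def)
      then have "{(i, 0), (i, Suc 0)} \<in> edges (prism n)"
        unfolding prism_def cartesian_product_def graph.simps by blast
      from walk_edge[OF simple this] down[OF v(2)] show ?thesis
        unfolding v(1) \<open>b = Suc 0\<close> by (meson walk_append)
    qed
  qed
  have "(0, 0) \<in> verts (prism n)"
    using assms by (simp add: prism_def cartesian_product_def cycle_graph_def path_graph_def)
  moreover have "\<exists>p. walk (prism n) u p v" 
    if uv: "u \<in> verts (prism n)" "v \<in> verts (prism n)" for u v
  proof -
    obtain p q where p: "walk (prism n) (0, 0) p u" and q: "walk (prism n) (0, 0) q v"
      using base[OF uv(1)] base[OF uv(2)] by blast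
    show ?thesis
      using walk_append[OF walk_rev[OF p] q] by (rule exI)
  qed
  ultimately show ?thesis
    unfolding connected_graph_def by blast
qed

end

(* Lower bound: for a two-element set {x, y} the map e |-> d(e, x) - d(e, y) would have to be
   injective on the 3 n edges, but all distances are at most n + 1, which leaves 2 n + 3 values.
   Upper bound: with m = (n + 3) div 2, an outer edge, the spoke two positions further on and the
   spoke at position m resolve. Distances in the line graph are read off from a potential on the
   vertices that drops towards the landmark edge and changes by at most 1 along each edge. *)

theory Submission
  imports Defs
begin

section \<open>Graph distance computed from a potential\<close>

text \<open>Each descending step lowers \<phi> by at least 1, so following such steps must stop,
  which can only happen at \<open>v\<close>, after at most \<open>\<phi> u\<close> steps.\<close>

lemma walk_descend:
  assumes "v \<in> verts G"
    and "\<And>u. u \<in> verts G \<Longrightarrow> u \<noteq> v \<Longrightarrow> \<exists>w \<in> verts G. {u, w} \<in> edges G \<and> \<phi> w < (\<phi> u :: nat)"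
    and "u \<in> verts G"
  shows "\<exists>p k. walk G u p v \<and> length p = Suc k \<and> k \<le> \<phi> u"
  using assms(3)
proof (induction "\<phi> u" arbitrary: u rule: less_induct)
  case less
  show ?case
  proof (cases "u = v")
    case True
    then show ?thesis
      using assms(1) by (intro exI[of _ "[v]"]) (simp add: walk_def)
  next
    case False
    then obtain w where w: "w \<in> verts G" "{u, w} \<in> edges G" "\<phi> w < \<phi> u"
      using assms(2) less.prems by blast
    then obtain p k where "walk G w p v" "length p = Suc k" "k \<le> \<phi> w"
      using less.hyps by blast
    with w less.prems show ?thesis
      by (intro exI[of _ "u # p"] exI[of _ "Suc k"])
        (cases p; auto simp: walk_def)
  qed
qed

lemma graph_dist_le_potential:
  assumes "v \<in> verts G"
    and "\<And>u. u \<in> verts G \<Longrightarrow> u \<noteq> v \<Longrightarrow> \<exists>w \<in> verts G. {u, w} \<in> edges G \<and> \<phi> w < (\<phi> u :: nat)"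
    and "u \<in> verts G"
  shows "graph_dist G u v \<le> \<phi> u"
proof -
  obtain p k where "walk G u p v" "length p = Suc k" "k \<le> \<phi> u"
    using walk_descend[of v G \<phi> u] assms by blast
  then have "graph_dist G u v \<le> k"
    unfolding graph_dist_def by (blast intro: Least_le)
  with \<open>k \<le> \<phi> u\<close> show ?thesis by simp
qed

text \<open>One step of a walk can lower \<phi> by at most 1; induction along the walk adds this
  up.\<close>

lemma potential_le_walk_length:
  assumes "\<And>u w. {u, w} \<in> edges G \<Longrightarrow> \<phi> u \<le> Suc (\<phi> w)"
    and "walk G u p v" "length p = Suc k"
  shows "\<phi> u \<le> \<phi> v + k"
  using assms(2,3)
proof (induction p arbitrary: u k)
  case (Cons x p)
  show ?case
  proof (cases p)
    case Nil
    with Cons.prems show ?thesis by (auto simp: walk_def)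
  next
    case (Cons y q)
    with Cons.prems obtain l where "walk G y p v" "length p = Suc l" "k = Suc l" "{u, y} \<in> edges G"
      by (auto simp: walk_def)
    with Cons.IH[of y l] assms(1)[of u y] show ?thesis by simp
  qed
qed simp

lemma graph_dist_eq_potential:
  assumes v: "v \<in> verts G" "\<phi> v = 0"
    and descend: "\<And>u. u \<in> verts G \<Longrightarrow> u \<noteq> v \<Longrightarrow>
      \<exists>w \<in> verts G. {u, w} \<in> edges G \<and> \<phi> w < (\<phi> u :: nat)"
    and lipschitz: "\<And>u w. {u, w} \<in> edges G \<Longrightarrow> \<phi> u \<le> Suc (\<phi> w)"
    and u: "u \<in> verts G"
  shows "graph_dist G u v = \<phi> u"
proof (rule antisym)
  show "graph_dist G u v \<le> \<phi> u"
    using graph_dist_le_potential[of v G \<phi> u] assms by blast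
  \<comment> \<open>The descending walk also shows that the \<open>LEAST\<close> in
    \<open>graph_dist\<close> is attained, so the Lipschitz bound can be applied to a shortest
    walk.\<close>
  have "\<exists>k p. walk G u p v \<and> length p = Suc k"
    using walk_descend[of v G \<phi> u] assms by blast
  then have "\<exists>p. walk G u p v \<and> length p = Suc (graph_dist G u v)"
    unfolding graph_dist_def by (rule LeastI_ex)
  then show "\<phi> u \<le> graph_dist G u v"
    using potential_le_walk_length[of G \<phi>, OF lipschitz] v(2) by fastforce
qed

section \<open>From vertex potentials to distances between edges\<close>

lemma edge_shape:
  assumes "simple_graph G" "e \<in> edges G" "u \<in> e"
  obtains v where "e = {u, v}" "v \<noteq> u"
  using assms unfolding simple_graph_def by (metis card_2_iff insertE insert_commute singletonD)

lemma edges_line_graph: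
  "{e, f} \<in> edges (line_graph G) \<longleftrightarrow> e \<in> edges G \<and> f \<in> edges G \<and> e \<noteq> f \<and> e \<inter> f \<noteq> {}"
  by (auto simp: line_graph_def doubleton_eq_iff)

text \<open>A vertex potential \<open>h\<close> that vanishes exactly on the edge \<open>x\<close> induces the potential
  \<open>1 + min h\<close> on the other vertices of the line graph.\<close>

definition edge_potential :: "('a \<Rightarrow> nat) \<Rightarrow> 'a set \<Rightarrow> 'a set \<Rightarrow> nat" where
  "edge_potential h x e = (if e = x then 0 else Suc (Min (h ` e)))"

lemma Min_image_le:
  assumes "simple_graph G" "e \<in> edges G" "u \<in> e"
  shows "Min (h ` e) \<le> (h u :: nat)"
  by (rule edge_shape[OF assms]) simp

text \<open>Take an end \<open>u\<close> of \<open>e\<close> with minimal \<open>h\<close>. If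
  \<open>h u = 0\<close>, then \<open>u\<close> lies on \<open>x\<close> and the next edge is
  \<open>x\<close> itself; otherwise it is an edge from \<open>u\<close> to a lower vertex.\<close>

lemma edge_potential_descend:
  assumes G: "simple_graph G" and x: "x \<in> edges G"
    and zero: "\<And>v. v \<in> verts G \<Longrightarrow> h v = 0 \<Longrightarrow> v \<in> x"
    and descend: "\<And>v. v \<in> verts G \<Longrightarrow> 0 < h v \<Longrightarrow> \<exists>w. {v, w} \<in> edges G \<and> h w < h v"
    and e: "e \<in> edges G" "e \<noteq> x"
  shows "\<exists>f \<in> edges G. {e, f} \<in> edges (line_graph G) \<and> edge_potential h x f < edge_potential h x e"
proof -
  have "finite e" "e \<noteq> {}" "e \<subseteq> verts G"
    using G e(1) unfolding simple_graph_def by (auto intro: card_ge_0_finite)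
  then have "Min (h ` e) \<in> h ` e" by simp
  then obtain u where u: "u \<in> e" "Min (h ` e) = h u" by auto
  then have val: "edge_potential h x e = Suc (h u)" and uG: "u \<in> verts G"
    using e \<open>e \<subseteq> verts G\<close> by (auto simp: edge_potential_def)
  show ?thesis
  proof (cases "h u = 0")
    case True
    then have "u \<in> x" using zero uG by simp
    with u x e have "{e, x} \<in> edges (line_graph G)"
      unfolding edges_line_graph by blast
    with x val show ?thesis
      by (intro bexI[of _ x]) (simp_all add: edge_potential_def)
  next
    case False
    then obtain w where w: "{u, w} \<in> edges G" "h w < h u"
      using descend uG by blast
    from Min_image_le[OF G w(1), of w h] w(2) val
    have less: "edge_potential h x {u, w} < edge_potential h x e"
      by (simp add: edge_potential_def)
    \<comment> \<open>The strict drop already forces the two edges to differ, as adjacency in the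
      line graph demands.\<close>
    then have "{u, w} \<noteq> e" by auto
    moreover have "u \<in> e \<inter> {u, w}" using u by simp
    ultimately have "{e, {u, w}} \<in> edges (line_graph G)"
      unfolding edges_line_graph using w(1) e(1) by blast
    with w(1) less show ?thesis by (intro bexI conjI)
  qed
qed

lemma verts_line_graph: "verts (line_graph G) = edges G"
  by (simp add: line_graph_def)

text \<open>Descent alone bounds the distance from above. Since \<open>h\<close> may vanish on just
  one end of \<open>x\<close>, distances to a single vertex can serve as \<open>h\<close>.\<close>

lemma edge_dist_le_potential:
  assumes G: "simple_graph G" and x: "x \<in> edges G"
    and zero: "\<And>v. v \<in> verts G \<Longrightarrow> h v = 0 \<Longrightarrow> v \<in> x"
    and descend: "\<And>v. v \<in> verts G \<Longrightarrow> 0 < h v \<Longrightarrow> \<exists>w. {v, w} \<in> edges G \<and> h w < h v"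
    and e: "e \<in> edges G"
  shows "edge_dist G e x \<le> edge_potential h x e"
proof -
  have "\<exists>f \<in> edges G. {e, f} \<in> edges (line_graph G) \<and> edge_potential h x f < edge_potential h x e"
    if "e \<in> edges G" "e \<noteq> x" for e
    by (rule edge_potential_descend[where h = h, OF G x zero descend that])
  with x e show ?thesis
    unfolding edge_dist_def
    by (intro graph_dist_le_potential[where \<phi> = "edge_potential h x"]) (simp_all only: verts_line_graph)
qed

text \<open>The Lipschitz condition passes to edges: adjacent \<open>f\<close> and \<open>g\<close>
  share a vertex \<open>v\<close>, the minimum of \<open>h\<close> on \<open>f\<close> is at most
  \<open>h v\<close>, and \<open>h v\<close> exceeds the minimum on \<open>g\<close> by at most
  1.\<close>

lemma edge_dist_eq_potential:
  assumes G: "simple_graph G" and x: "x \<in> edges G"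
    and zero: "\<And>v. v \<in> verts G \<Longrightarrow> h v = 0 \<longleftrightarrow> v \<in> x"
    and descend: "\<And>v. v \<in> verts G \<Longrightarrow> 0 < h v \<Longrightarrow> \<exists>w. {v, w} \<in> edges G \<and> h w < h v"
    and lipschitz: "\<And>v w. {v, w} \<in> edges G \<Longrightarrow> h v \<le> Suc (h w)"
    and e: "e \<in> edges G"
  shows "edge_dist G e x = edge_potential h x e"
proof -
  have step: "\<exists>f \<in> edges G. {e, f} \<in> edges (line_graph G) \<and> edge_potential h x f < edge_potential h x e"
    if "e \<in> edges G" "e \<noteq> x" for e
    by (rule edge_potential_descend[where h = h, OF G x _ descend that]) (simp add: zero)
  have lip: "edge_potential h x f \<le> Suc (edge_potential h x g)"
    if "{f, g} \<in> edges (line_graph G)" for f g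
  proof -
    from that have fg: "f \<in> edges G" "g \<in> edges G" "f \<inter> g \<noteq> {}"
      by (simp_all add: edges_line_graph)
    then obtain v where v: "v \<in> f" "v \<in> g" by blast
    have f: "Min (h ` f) \<le> h v" using Min_image_le[OF G fg(1) v(1)] .
    show ?thesis
    proof (cases "g = x")
      case True
      \<comment> \<open>The landmark has potential 0 instead of 1; this is made up for by
        \<open>h\<close> vanishing at the shared vertex.\<close>
      have "v \<in> verts G" using G v(1) fg(1) unfolding simple_graph_def by blast
      then have "h v = 0" using zero v(2) True by simp
      with f show ?thesis by (simp add: edge_potential_def)
    next
      case False
      obtain w where "g = {v, w}" by (rule edge_shape[OF G fg(2) v(2)])
      moreover have "h v \<le> Suc (h w)" using lipschitz[of v w] fg(2) \<open>g = {v, w}\<close> by simp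
      ultimately have "h v \<le> Suc (Min (h ` g))" by (simp add: min_def)
      with f False show ?thesis by (simp add: edge_potential_def)
    qed
  qed
  show ?thesis
    unfolding edge_dist_def
  proof (rule graph_dist_eq_potential[where \<phi> = "edge_potential h x", unfolded verts_line_graph])
    show "x \<in> verts (line_graph G)" "e \<in> verts (line_graph G)"
      by (simp_all add: verts_line_graph x e)
    show "edge_potential h x x = 0" by (simp add: edge_potential_def)
    show "\<exists>w \<in> verts (line_graph G). {u, w} \<in> edges (line_graph G) \<and>
        edge_potential h x w < edge_potential h x u"
      if "u \<in> verts (line_graph G)" "u \<noteq> x" for u
      using that unfolding verts_line_graph by (rule step)
  qed (rule lip)
qed

section \<open>The edges of the prism\<close>

text \<open>\<open>x\<close> selects the copy of the cycle: 0 for the outer, 1 for the inner one.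
  Rungs are the spokes.\<close>

definition rail :: "nat \<Rightarrow> nat \<Rightarrow> nat \<Rightarrow> (nat \<times> nat) set" where
  "rail n x i = {(i, x), (Suc i mod n, x)}"

definition rung :: "nat \<Rightarrow> (nat \<times> nat) set" where
  "rung i = {(i, 0), (i, 1)}"

lemma rail_neq_rung: "rail n x i \<noteq> rung j"
  by (auto simp: rail_def rung_def doubleton_eq_iff)

text \<open>For \<open>n = 2\<close> the two rails of a copy would have the same ends; from
  \<open>n = 3\<close> on, the ends determine the starting position.\<close>

lemma rail_eq_iff:
  assumes "n \<ge> 3" "i < n" "j < n"
  shows "rail n x i = rail n y j \<longleftrightarrow> x = y \<and> i = j"
  using assms by (cases "Suc i = n"; cases "Suc j = n") (auto simp: rail_def doubleton_eq_iff)

lemma verts_prism: "verts (prism n) = {..<n} \<times> {..<2}"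
  by (simp add: prism_def cartesian_product_def cycle_graph_def path_graph_def)

lemma edges_prism: "edges (prism n) = {rail n x i | x i. x < 2 \<and> i < n} \<union> {rung i | i. i < n}"
proof -
  have cycle: "{u, v} \<in> edges (cycle_graph n) \<longleftrightarrow>
      (\<exists>i<n. (u = i \<and> v = Suc i mod n) \<or> (v = i \<and> u = Suc i mod n))" for u v
    by (auto simp: cycle_graph_def doubleton_eq_iff)
  have path: "{x, y} \<in> edges (path_graph 2) \<longleftrightarrow> (x = 0 \<and> y = 1) \<or> (x = 1 \<and> y = 0)" for x y
    by (auto simp: path_graph_def doubleton_eq_iff)
  have "{{(u, x), (v, x)} | u v x. {u, v} \<in> edges (cycle_graph n) \<and> x \<in> verts (path_graph 2)} =
      {rail n x i | x i. x < 2 \<and> i < n}" (is "?L = ?R")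
  proof
    show "?L \<subseteq> ?R"
      unfolding cycle rail_def by (auto simp: path_graph_def)
    show "?R \<subseteq> ?L"
      unfolding cycle rail_def path_graph_def by simp blast
  qed
  moreover have "{{(u, x), (u, y)} | u x y. u \<in> verts (cycle_graph n) \<and> {x, y} \<in> edges (path_graph 2)} =
      {rung i | i. i < n}" (is "?L = ?R")
  proof
    show "?L \<subseteq> ?R"
      unfolding path rung_def by (auto simp: cycle_graph_def)
    show "?R \<subseteq> ?L"
      unfolding path rung_def cycle_graph_def by simp blast
  qed
  ultimately show ?thesis
    unfolding prism_def cartesian_product_def by simp
qed

lemma prism_edge_cases:
  assumes "{v, w} \<in> edges (prism n)"
  obtains (forward) x i where "x < 2" "i < n" "v = (i, x)" "w = (Suc i mod n, x)"
    | (backward) x i where "x < 2" "i < n" "v = (Suc i mod n, x)" "w = (i, x)"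
    | (up) i where "i < n" "v = (i, 0)" "w = (i, 1)"
    | (down) i where "i < n" "v = (i, 1)" "w = (i, 0)"
  using assms unfolding edges_prism rail_def rung_def
  by (auto simp: doubleton_eq_iff)

text \<open>These are the moves for the descent arguments, with the successor modulo
  \<open>n\<close> split into interior moves and moves across the seam between \<open>n - 1\<close>
  and 0.\<close>

lemma prism_edgeI:
  shows "x < 2 \<Longrightarrow> Suc i < n \<Longrightarrow> {(i, x), (Suc i, x)} \<in> edges (prism n)"
    and "x < 2 \<Longrightarrow> 0 < i \<Longrightarrow> i < n \<Longrightarrow> {(i, x), (i - 1, x)} \<in> edges (prism n)"
    and "x < 2 \<Longrightarrow> Suc i = n \<Longrightarrow> {(i, x), (0, x)} \<in> edges (prism n)"
    and "x < 2 \<Longrightarrow> 0 < n \<Longrightarrow> {(0, x), (n - 1, x)} \<in> edges (prism n)"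
    and "x < 2 \<Longrightarrow> y < 2 \<Longrightarrow> x \<noteq> y \<Longrightarrow> i < n \<Longrightarrow> {(i, x), (i, y)} \<in> edges (prism n)"
proof -
  have rail: "{(i, x), (Suc i mod n, x)} \<in> edges (prism n)" if "x < 2" "i < n" for i x
    using that unfolding edges_prism rail_def by blast
  show "{(i, x), (Suc i, x)} \<in> edges (prism n)" if "x < 2" "Suc i < n"
    using rail[of x i] that by simp
  show "{(i, x), (i - 1, x)} \<in> edges (prism n)" if "x < 2" "0 < i" "i < n"
    using rail[of x "i - 1"] that by (simp add: insert_commute)
  show "{(i, x), (0, x)} \<in> edges (prism n)" if "x < 2" "Suc i = n"
    using rail[of x i] that by auto
  show "{(0, x), (n - 1, x)} \<in> edges (prism n)" if "x < 2" "0 < n"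
    using rail[of x "n - 1"] that by (simp add: insert_commute)
  show "{(i, x), (i, y)} \<in> edges (prism n)" if "x < 2" "y < 2" "x \<noteq> y" "i < n"
  proof -
    have "x = 0 \<and> y = 1 \<or> x = 1 \<and> y = 0" using that by auto
    with \<open>i < n\<close> show ?thesis
      unfolding edges_prism rung_def by (auto simp: insert_commute)
  qed
qed

lemma card_edges_prism:
  assumes "n \<ge> 3"
  shows "finite (edges (prism n))" "card (edges (prism n)) = 3 * n"
proof -
  \<comment> \<open>The index 2, one beyond the two copies, stands for the rungs, so a 3 by
    \<open>n\<close> grid parametrises all edges.\<close>
  define E where "E = (\<lambda>(x, i). if x = (2::nat) then rung i else rail n x i)"
  have im: "edges (prism n) = E ` ({..<3} \<times> {..<n})"
  proof -
    have three: "x < 3 \<longleftrightarrow> x < 2 \<or> x = 2" for x :: nat by auto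
    show ?thesis
      unfolding edges_prism E_def by (force simp: three image_iff)
  qed
  have "inj_on E ({..<3} \<times> {..<n})"
  proof (rule inj_onI)
    fix p q
    assume "p \<in> {..<3} \<times> {..<n}" "q \<in> {..<3} \<times> {..<n}" "E p = E q"
    moreover obtain x i y j where "p = (x, i)" "q = (y, j)" by fastforce
    ultimately show "p = q"
      using assms rail_neq_rung rail_neq_rung[symmetric] rail_eq_iff[of n]
      by (auto simp: E_def rung_def doubleton_eq_iff split: if_splits)
  qed
  then show "card (edges (prism n)) = 3 * n"
    by (simp add: im card_image)
  show "finite (edges (prism n))" by (simp add: im)
qed

section \<open>Distances in the line graph of the prism\<close>

lemma edge_dist_prism_le:
  assumes n: "n \<ge> 3" and e: "e \<in> edges (prism n)" and x: "x \<in> edges (prism n)"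
  shows "edge_dist (prism n) e x \<le> n + 1"
proof -
  have vertex: thesis if "e \<in> edges (prism n)" "\<And>v. v \<in> e \<Longrightarrow> v \<in> verts (prism n) \<Longrightarrow> thesis"
    for e thesis
  proof -
    have "e \<subseteq> verts (prism n)" "e \<noteq> {}"
      using simple_prism[OF n] that(1) unfolding simple_graph_def by fastforce+
    with that(2) show thesis by blast
  qed
  obtain u where u: "u \<in> e" "u \<in> verts (prism n)" by (rule vertex[OF e])
  obtain v where v: "v \<in> x" "v \<in> verts (prism n)" by (rule vertex[OF x])
  obtain j z where jz: "v = (j, z)" "j < n" "z < 2" using v by (auto simp: verts_prism)
  \<comment> \<open>Truncated subtraction makes the sum an absolute difference. This is the length
    of a route to \<open>v\<close> that never crosses the seam: at most \<open>n - 1\<close> steps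
    along the cycle and 1 between the copies.\<close>
  define h where "h = (\<lambda>(i, y). (i - j) + (j - i) + (if y = z then 0 else 1 :: nat))"
  have "edge_dist (prism n) e x \<le> edge_potential h x e"
  proof (rule edge_dist_le_potential[where h = h, OF simple_prism[OF n] x _ _ e])
    show "w \<in> x" if "w \<in> verts (prism n)" "h w = 0" for w
      using that v jz by (auto simp: h_def split: if_splits prod.splits)
    show "\<exists>w'. {w, w'} \<in> edges (prism n) \<and> h w' < h w" if w: "w \<in> verts (prism n)" "0 < h w" for w
    proof -
      obtain i y where iy: "w = (i, y)" "i < n" "y < 2" using w by (auto simp: verts_prism)
      consider "y \<noteq> z" | "y = z" "i < j" | "y = z" "j < i"
        using w iy by (force simp: h_def)
      then show ?thesis
      proof cases
        case 1
        with iy jz show ?thesis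
          by (intro exI[of _ "(i, z)"]) (simp add: prism_edgeI h_def)
      next
        case 2
        with iy jz show ?thesis
          by (intro exI[of _ "(Suc i, y)"]) (simp add: prism_edgeI h_def)
      next
        case 3
        with iy jz show ?thesis
          by (intro exI[of _ "(i - 1, y)"]) (simp add: prism_edgeI[simplified] h_def)
      qed
    qed
  qed
  also have "edge_potential h x e \<le> Suc (h u)"
    using Min_image_le[OF simple_prism[OF n] e u(1), of h] by (simp add: edge_potential_def)
  also have "h u \<le> n"
    using u(2) jz by (auto simp: verts_prism h_def)
  finally show ?thesis by simp
qed

text \<open>The length of the shorter arc. The argument \<open>i = n\<close> is meaningful too and
  agrees with \<open>i = 0\<close> for \<open>j < n\<close>.\<close>

definition cyclic_dist :: "nat \<Rightarrow> nat \<Rightarrow> nat \<Rightarrow> nat" where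
  "cyclic_dist n i j = min ((i - j) + (j - i)) (n - ((i - j) + (j - i)))"

lemma cyclic_dist_cases:
  "i \<le> j \<Longrightarrow> 2 * (j - i) \<le> n \<Longrightarrow> cyclic_dist n i j = j - i"
  "i \<le> j \<Longrightarrow> n \<le> 2 * (j - i) \<Longrightarrow> cyclic_dist n i j = n - (j - i)"
  "j \<le> i \<Longrightarrow> 2 * (i - j) \<le> n \<Longrightarrow> cyclic_dist n i j = i - j"
  "j \<le> i \<Longrightarrow> n \<le> 2 * (i - j) \<Longrightarrow> cyclic_dist n i j = n - (i - j)"
  by (simp_all add: cyclic_dist_def)

text \<open>A rung contains both vertices at position \<open>j\<close>, so the vertex potential
  depends on the position alone.\<close>

lemma edge_dist_rung:
  assumes n: "n \<ge> 3" and j: "j < n" and e: "e \<in> edges (prism n)"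
  shows "edge_dist (prism n) e (rung j) = edge_potential (\<lambda>v. cyclic_dist n (fst v) j) (rung j) e"
proof (rule edge_dist_eq_potential[OF simple_prism[OF n] _ _ _ _ e])
  show "rung j \<in> edges (prism n)" using j by (auto simp: edges_prism)
  show "cyclic_dist n (fst v) j = 0 \<longleftrightarrow> v \<in> rung j" if "v \<in> verts (prism n)" for v
    using that j by (auto simp: verts_prism rung_def cyclic_dist_def min_def split: if_splits)
  show "\<exists>w. {v, w} \<in> edges (prism n) \<and> cyclic_dist n (fst w) j < cyclic_dist n (fst v) j"
    if v: "v \<in> verts (prism n)" "0 < cyclic_dist n (fst v) j" for v
  proof -
    obtain i y where iy: "v = (i, y)" "i < n" "y < 2" using v by (auto simp: verts_prism)
    note edge = prism_edgeI(1-4)[of y]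
    have "i \<noteq> j" using v(2) iy(1) by (auto simp: cyclic_dist_def)
    \<comment> \<open>The descent follows the shorter arc; the cases record the side of
      \<open>j\<close>, the direction, and whether the move crosses the seam.\<close>
    then consider "i < j" "2 * (j - i) \<le> n" | "i < j" "2 * (j - i) > n" "i = 0"
      | "i < j" "2 * (j - i) > n" "i > 0" | "j < i" "2 * (i - j) \<le> n"
      | "j < i" "2 * (i - j) > n" "Suc i = n" | "j < i" "2 * (i - j) > n" "Suc i < n"
      using iy(2) by (meson Suc_lessI gr0I linorder_neqE_nat not_le)
    then show ?thesis
    proof cases
      case 1
      with iy j edge(1)[of i n] show ?thesis
        by (intro exI[of _ "(Suc i, y)"]) (simp add: cyclic_dist_cases)
    next
      case 2
      with iy j edge(4)[of n] show ?thesis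
        by (intro exI[of _ "(n - 1, y)"]) (simp add: cyclic_dist_cases)
    next
      case 3
      with iy j edge(2)[of i n] show ?thesis
        by (intro exI[of _ "(i - 1, y)"]) (simp add: cyclic_dist_cases)
    next
      case 4
      with iy j edge(2)[of i n] show ?thesis
        by (intro exI[of _ "(i - 1, y)"]) (simp add: cyclic_dist_cases)
    next
      case 5
      with iy j edge(3)[of i n] show ?thesis
        by (intro exI[of _ "(0, y)"]) (simp add: cyclic_dist_cases)
    next
      case 6
      with iy j edge(1)[of i n] show ?thesis
        by (intro exI[of _ "(Suc i, y)"]) (simp add: cyclic_dist_cases)
    qed
  qed
  have step: "cyclic_dist n i j \<le> Suc (cyclic_dist n (Suc i mod n) j) \<and>
      cyclic_dist n (Suc i mod n) j \<le> Suc (cyclic_dist n i j)" if "i < n" for i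
    using that j by (cases "Suc i = n") (simp_all add: cyclic_dist_def, linarith+)
  show "cyclic_dist n (fst v) j \<le> Suc (cyclic_dist n (fst w) j)" if "{v, w} \<in> edges (prism n)" for v w
    using that by (cases rule: prism_edge_cases) (use step in auto)
qed

text \<open>The distance to the nearer end of \<open>rail n 0 0\<close>: back to position 1 or on to
  position \<open>n\<close>, which is 0, plus 1 for leaving the inner copy.\<close>

definition rail_potential :: "nat \<Rightarrow> nat \<times> nat \<Rightarrow> nat" where
  "rail_potential n v = (if fst v = 0 then 0 else min (fst v - 1) (n - fst v)) + snd v"

lemma edge_dist_rail:
  assumes n: "n \<ge> 3" and e: "e \<in> edges (prism n)"
  shows "edge_dist (prism n) e (rail n 0 0) = edge_potential (rail_potential n) (rail n 0 0) e"
proof (rule edge_dist_eq_potential[OF simple_prism[OF n] _ _ _ _ e])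
  show "rail n 0 0 \<in> edges (prism n)" using n by (fastforce simp: edges_prism)
  show "rail_potential n v = 0 \<longleftrightarrow> v \<in> rail n 0 0" if "v \<in> verts (prism n)" for v
    using that n by (auto simp: verts_prism rail_def rail_potential_def min_def split: if_splits)
  show "\<exists>w. {v, w} \<in> edges (prism n) \<and> rail_potential n w < rail_potential n v"
    if v: "v \<in> verts (prism n)" "0 < rail_potential n v" for v
  proof -
    obtain i y where iy: "v = (i, y)" "i < n" "y < 2" using v by (auto simp: verts_prism)
    \<comment> \<open>From the inner copy change to the outer one first. There,
      \<open>2 * i \<le> Suc n\<close> says that position 1 is at most as far as position
      \<open>n\<close>.\<close>
    consider "y = 1" | "y = 0" "i > 1" "2 * i \<le> Suc n" | "y = 0" "2 * i > Suc n" "Suc i = n"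
      | "y = 0" "2 * i > Suc n" "Suc i < n"
      using v iy by (fastforce simp: rail_potential_def split: if_splits)
    then show ?thesis
    proof cases
      case 1
      with iy prism_edgeI(5)[of 1 0 i n] show ?thesis
        by (intro exI[of _ "(i, 0)"]) (auto simp: rail_potential_def)
    next
      case 2
      with iy prism_edgeI(2)[of 0 i n] show ?thesis
        by (intro exI[of _ "(i - 1, 0)"]) (auto simp: rail_potential_def)
    next
      case 3
      with iy n prism_edgeI(3)[of 0 i n] show ?thesis
        by (intro exI[of _ "(0, 0)"]) (auto simp: rail_potential_def)
    next
      case 4
      with iy prism_edgeI(1)[of 0 i n] show ?thesis
        by (intro exI[of _ "(Suc i, 0)"]) (auto simp: rail_potential_def)
    qed
  qed
  have step: "rail_potential n (i, x) \<le> Suc (rail_potential n (Suc i mod n, x)) \<and>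
      rail_potential n (Suc i mod n, x) \<le> Suc (rail_potential n (i, x))" if "i < n" for i x
    using that n by (cases "Suc i = n") (auto simp: rail_potential_def)
  show "rail_potential n v \<le> Suc (rail_potential n w)" if "{v, w} \<in> edges (prism n)" for v w
    using that by (cases rule: prism_edge_cases) (use step in \<open>auto simp: rail_potential_def\<close>)
qed

lemma edge_dist_rung_simps:
  assumes n: "n \<ge> 3" and j: "j < n" and i: "i < n"
  shows "edge_dist (prism n) (rung i) (rung j) = (if i = j then 0 else Suc (cyclic_dist n i j))"
    and "x < 2 \<Longrightarrow> edge_dist (prism n) (rail n x i) (rung j) =
      Suc (min (cyclic_dist n i j) (cyclic_dist n (Suc i) j))"
proof -
  have "rung i \<in> edges (prism n)" using i by (auto simp: edges_prism)
  from edge_dist_rung[OF n j this]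
  show "edge_dist (prism n) (rung i) (rung j) = (if i = j then 0 else Suc (cyclic_dist n i j))"
    by (simp add: edge_potential_def rung_def doubleton_eq_iff)
next
  assume x: "x < 2"
  then have "rail n x i \<in> edges (prism n)" using i by (auto simp: edges_prism)
  from edge_dist_rung[OF n j this] rail_neq_rung
  have "edge_dist (prism n) (rail n x i) (rung j) =
      Suc (min (cyclic_dist n i j) (cyclic_dist n (Suc i mod n) j))"
    by (simp add: edge_potential_def rail_def)
  \<comment> \<open>This lets the far end of the last rail be written as position \<open>n\<close>,
    without \<open>mod\<close>.\<close>
  moreover have "cyclic_dist n 0 j = cyclic_dist n n j"
    using j by (simp add: cyclic_dist_def min.commute)
  ultimately show "edge_dist (prism n) (rail n x i) (rung j) =
      Suc (min (cyclic_dist n i j) (cyclic_dist n (Suc i) j))"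
    using i by (cases "Suc i = n") simp_all
qed

text \<open>For \<open>i > 0\<close> the nearer end of a rail is
  \<open>min (i - 1) (n - i - 1)\<close> away within its copy, and the extra 1 turns this into
  \<open>min i (n - i)\<close>. At \<open>i = 0\<close> the landmark has distance 0 and the opposite
  rail 2.\<close>

lemma edge_dist_rail_simps:
  assumes n: "n \<ge> 3" and i: "i < n"
  shows "edge_dist (prism n) (rung i) (rail n 0 0) = (if i = 0 then 1 else Suc (min (i - 1) (n - i)))"
    and "x < 2 \<Longrightarrow> edge_dist (prism n) (rail n x i) (rail n 0 0) =
      (if i = 0 then 2 * x else min i (n - i) + x)"
proof -
  have "rung i \<in> edges (prism n)" using i by (auto simp: edges_prism)
  from edge_dist_rail[OF n this]
  show "edge_dist (prism n) (rung i) (rail n 0 0) = (if i = 0 then 1 else Suc (min (i - 1) (n - i)))"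
    by (simp add: edge_potential_def rung_def rail_def doubleton_eq_iff rail_potential_def)
next
  assume x: "x < 2"
  then have "rail n x i \<in> edges (prism n)" using i by (auto simp: edges_prism)
  from edge_dist_rail[OF n this]
  have dist: "edge_dist (prism n) (rail n x i) (rail n 0 0) = (if x = 0 \<and> i = 0 then 0
      else Suc (min (rail_potential n (i, x)) (rail_potential n (Suc i mod n, x))))"
    using rail_eq_iff[OF n i, of 0 x 0] n by (simp add: edge_potential_def rail_def)
  show "edge_dist (prism n) (rail n x i) (rail n 0 0) = (if i = 0 then 2 * x else min i (n - i) + x)"
  proof (cases "i = 0")
    case True
    with n x dist show ?thesis by (auto simp: rail_potential_def)
  next
    case False
    with n i dist show ?thesis
      by (cases "Suc i = n") (simp_all add: rail_potential_def, linarith)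
  qed
qed

section \<open>The lower bound by counting\<close>

lemma card_edge_doubly_resolving_set_prism:
  assumes n: "n \<ge> 6" and D: "edge_doubly_resolving_set (prism n) D" "finite D"
  shows "card D \<ge> 3"
proof (rule ccontr)
  assume "\<not> card D \<ge> 3"
  then have "card D = 0 \<or> card D = 1 \<or> card D = 2" by linarith
  \<comment> \<open>Taking \<open>x = y\<close> covers singletons; for empty \<open>D\<close> the
    two are arbitrary.\<close>
  then obtain x y where xy: "D \<subseteq> {x, y}" "D \<noteq> {} \<Longrightarrow> x \<in> D \<and> y \<in> D"
    using D(2) by (fastforce simp: card_2_iff card_1_singleton_iff)
  define f where "f e = int (edge_dist (prism n) e x) - int (edge_dist (prism n) e y)" for e
  define E where "E = edges (prism n)"
  have E: "finite E" "card E = 3 * n" using card_edges_prism[of n] n by (simp_all add: E_def)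
  have resolve: "\<exists>a\<in>D. \<exists>b\<in>D. edge_doubly_resolve (prism n) a b e e'" if "e \<in> E" "e' \<in> E" "e \<noteq> e'" for e e'
    using that D(1) unfolding edge_doubly_resolving_set_def E_def by blast
  have "inj_on f E"
  proof (rule inj_onI, rule ccontr)
    fix e e'
    assume *: "e \<in> E" "e' \<in> E" "f e = f e'" "e \<noteq> e'"
    obtain a b where ab: "a \<in> D" "b \<in> D" "edge_doubly_resolve (prism n) a b e e'"
      using resolve[OF *(1,2,4)] by (elim bexE)
    \<comment> \<open>For \<open>a = b\<close> both differences are 0, and swapping \<open>x\<close>
      and \<open>y\<close> only changes the sign of \<open>f\<close>; so \<open>f\<close> alone
      would have to separate the edges.\<close>
    then have "(a = x \<or> a = y) \<and> (b = x \<or> b = y)"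
      using xy(1) by auto
    with *(3) ab(3) show False
      unfolding edge_doubly_resolve_def f_def by auto
  qed
  \<comment> \<open>Any two distinct edges show that \<open>D\<close> is nonempty, so
    \<open>x\<close> and \<open>y\<close> are edges and the distance bound applies to them.\<close>
  have "rung 0 \<in> E" "rung 1 \<in> E" "rung 0 \<noteq> rung 1"
    using n by (auto simp: E_def edges_prism rung_def doubleton_eq_iff)
  from resolve[OF this] have "D \<noteq> {}" by blast
  then have "x \<in> E" "y \<in> E"
    using xy(2) D(1) unfolding edge_doubly_resolving_set_def E_def by blast+
  then have "f e \<in> {- int (n + 1)..int (n + 1)}" if "e \<in> E" for e
    using that edge_dist_prism_le[of n e x] edge_dist_prism_le[of n e y] n
    unfolding f_def E_def by simp
  then have "f ` E \<subseteq> {- int (n + 1)..int (n + 1)}" by blast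
  then have "card (f ` E) \<le> card {- int (n + 1)..int (n + 1)}"
    by (intro card_mono) simp_all
  then have "3 * n \<le> 2 * n + 3"
    using \<open>inj_on f E\<close> E by (simp add: card_image)
  with n show False by simp
qed

section \<open>Tables of differences and their injectivity\<close>

text \<open>Write \<open>n = 2 * k + b\<close> with \<open>b \<le> 1\<close>. The values \<open>P\<close> and \<open>Q\<close> are the distances to \<open>rung 2\<close> and
  to \<open>rung (k + b + 1)\<close>, each minus the distance to \<open>rail n 0 0\<close>.\<close>

definition rail_diffs :: "nat \<Rightarrow> nat \<Rightarrow> nat \<Rightarrow> nat \<Rightarrow> int \<Rightarrow> int \<Rightarrow> bool" where
  "rail_diffs k b x i P Q \<longleftrightarrow>
    i = 0 \<and> P = 2 - 2 * int x \<and> Q = int k - 2 * int x \<or>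
    i = 1 \<and> P = - int x \<and> Q = int k + int b - 1 - int x \<or>
    2 \<le> i \<and> i \<le> k \<and> P = - 1 - int x \<and> Q = int k + int b + 1 - 2 * int i - int x \<or>
    b = 1 \<and> i = k + 1 \<and> P = - int x \<and> Q = 1 - int k - int x \<or>
    i = k + b + 1 \<and> P = 1 + int b - int x \<and> Q = 2 - int k - int x \<or>
    k + b + 2 \<le> i \<and> P = 2 - int x \<and> Q = 2 * int i - 3 * int k - 2 * int b - int x"

definition rung_diffs :: "nat \<Rightarrow> nat \<Rightarrow> nat \<Rightarrow> int \<Rightarrow> int \<Rightarrow> bool" where
  "rung_diffs k b i P Q \<longleftrightarrow>
    i = 0 \<and> P = 2 \<and> Q = int k - 1 \<or>
    i = 1 \<and> P = 1 \<and> Q = int k \<or>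
    i = 2 \<and> P = - 2 \<and> Q = int k + int b - 2 \<or>
    3 \<le> i \<and> i \<le> k + b \<and> P = - 1 \<and> Q = int k + int b + 2 - 2 * int i \<or>
    i = k + b + 1 \<and> P = int b \<and> Q = - int k \<or>
    k + b + 2 \<le> i \<and> P = 2 \<and> Q = 2 * int i - 3 * int k - 2 * int b - 1"

text \<open>On each row that covers a range of positions, \<open>Q\<close> has slope 2 or -2 in
  \<open>i\<close> and recovers the position; rows that agree in \<open>P\<close> have different
  \<open>Q\<close>.\<close>

lemma rail_diffs_inj:
  assumes "rail_diffs k b x i P Q" "rail_diffs k b y j P Q"
    and bounds: "b \<le> 1" "3 \<le> k" "x < 2" "y < 2" "i < 2 * k + b" "j < 2 * k + b"
  shows "x = y \<and> i = j"
  using assms(1,2) unfolding rail_diffs_def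
  by (elim disjE conjE; use bounds in linarith)

text \<open>Where a range of rails and a range of rungs share \<open>P\<close>, namely at -1 and 2,
  their \<open>Q\<close> have opposite parity. All other coincidences of \<open>P\<close> are
  separated by the size of \<open>Q\<close>.\<close>

lemma rail_rung_diffs_disjoint:
  assumes "rail_diffs k b x i P Q" "rung_diffs k b j P' Q'" "P = P'" "Q = Q'"
    and bounds: "x < 2" "b \<le> 1" "3 \<le> k" "i < 2 * k + b" "j < 2 * k + b"
  shows False
proof -
  \<comment> \<open>The first fact handles the rails at position 0, whose entries contain
    \<open>2 * int x\<close>; the other two compare \<open>Q\<close> on the ranges with
    \<open>P = -1\<close> and \<open>P = 2\<close>.\<close>
  have parity: "2 * int x \<noteq> 1" "- (2 * int i) \<noteq> 1 - 2 * int j" "2 * int i \<noteq> 2 * int j - 1"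
    by presburger+
  show ?thesis
    using assms(1-4) bounds unfolding rail_diffs_def rung_diffs_def
    by (elim disjE conjE) (simp_all add: parity)
qed

lemma rung_diffs_inj:
  assumes "rung_diffs k b i P Q" "rung_diffs k b j P Q"
    and "b \<le> 1" "3 \<le> k" "i < 2 * k + b" "j < 2 * k + b"
  shows "i = j"
  using assms unfolding rung_diffs_def
  by (elim disjE conjE) simp_all

section \<open>Distances to the three landmarks and their differences\<close>

context
  fixes n k b m :: nat
  assumes n: "n = 2 * k + b" "b \<le> 1" "k \<ge> 3" and m: "m = k + b + 1"
begin

lemma n_ge_3: "n \<ge> 3"
  using n by simp

lemma bounds:
  "2 * k + b \<le> n" "n \<le> 2 * k + b" "b \<le> 1" "3 \<le> k" "k + b + 1 \<le> m" "m \<le> k + b + 1" "m < n"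
  using n m by simp_all

text \<open>The value \<open>i = n\<close> is included because it is the far end of the last
  rail.\<close>

lemma cyclic_dist_2: "i \<le> n \<Longrightarrow> cyclic_dist n i 2 =
    (if i \<le> 2 then 2 - i else if i \<le> k + 2 then i - 2 else n + 2 - i)"
  using bounds by (cases "i \<le> 2"; cases "i \<le> k + 2") (simp_all add: cyclic_dist_cases)

text \<open>From positions 0 and 1 the arc backwards through \<open>n - 1\<close> is no longer than
  the forward one, which gives \<open>k - 1 + i\<close>.\<close>

lemma cyclic_dist_m: "i \<le> n \<Longrightarrow> cyclic_dist n i m =
    (if i \<le> 1 then k - 1 + i else if i \<le> m then m - i else i - m)"
  using bounds by (cases "i \<le> 1"; cases "i \<le> m") (simp_all add: cyclic_dist_cases)

lemma rail_rung_2: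
  assumes "i < n" "x < 2"
  shows "edge_dist (prism n) (rail n x i) (rung 2) =
    (if i \<le> 1 then 2 - i else if i \<le> k + b + 1 then i - 1 else n + 2 - i)"
proof -
  have "2 < n" using bounds by simp
  show ?thesis
    unfolding edge_dist_rung_simps(2)[OF n_ge_3 \<open>2 < n\<close> assms]
      cyclic_dist_2[OF less_imp_le[OF assms(1)]] cyclic_dist_2[OF Suc_leI[OF assms(1)]] min_def
    using bounds \<open>i < n\<close> by auto
qed

lemma rail_rung_m:
  assumes "i < n" "x < 2"
  shows "edge_dist (prism n) (rail n x i) (rung m) =
    (if i = 0 then k else if i \<le> k + b then k + b + 1 - i else i - (k + b))"
  unfolding edge_dist_rung_simps(2)[OF n_ge_3 bounds(7) assms]
    cyclic_dist_m[OF less_imp_le[OF assms(1)]] cyclic_dist_m[OF Suc_leI[OF assms(1)]] min_def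
  using bounds \<open>i < n\<close> by auto

lemma rung_rung_2:
  assumes "i < n"
  shows "edge_dist (prism n) (rung i) (rung 2) =
    (if i = 2 then 0 else if i \<le> 1 then 3 - i else if i \<le> k + 2 then i - 1 else n + 3 - i)"
proof -
  have "2 < n" using bounds by simp
  show ?thesis
    unfolding edge_dist_rung_simps(1)[OF n_ge_3 \<open>2 < n\<close> assms] cyclic_dist_2[OF less_imp_le[OF assms]]
    using bounds assms by auto
qed

lemma rung_rung_m:
  assumes "i < n"
  shows "edge_dist (prism n) (rung i) (rung m) =
    (if i = m then 0 else if i \<le> 1 then k + i else if i \<le> m then m + 1 - i else i + 1 - m)"
  unfolding edge_dist_rung_simps(1)[OF n_ge_3 bounds(7) assms] cyclic_dist_m[OF less_imp_le[OF assms]]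
  using bounds assms by auto

lemma rail_rail: "i < n \<Longrightarrow> x < 2 \<Longrightarrow> edge_dist (prism n) (rail n x i) (rail n 0 0) =
    (if i = 0 then 2 * x else if i \<le> k then i + x else n - i + x)"
  using n edge_dist_rail_simps(2)[OF n_ge_3, of i x] by auto

lemma rung_rail: "i < n \<Longrightarrow> edge_dist (prism n) (rung i) (rail n 0 0) =
    (if i = 0 then 1 else if i \<le> k + b then i else n + 1 - i)"
  using n edge_dist_rail_simps(1)[OF n_ge_3, of i] by auto

text \<open>\<open>rail n 0 0\<close> is the common reference: if two edges differ in
  \<open>diff2\<close> or \<open>diffm\<close>, it resolves them together with the corresponding
  rung.\<close>

definition diff2 :: "(nat \<times> nat) set \<Rightarrow> int" where
  "diff2 e = int (edge_dist (prism n) e (rung 2)) - int (edge_dist (prism n) e (rail n 0 0))"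

definition diffm :: "(nat \<times> nat) set \<Rightarrow> int" where
  "diffm e = int (edge_dist (prism n) e (rung m)) - int (edge_dist (prism n) e (rail n 0 0))"

lemma diff_rail:
  assumes "i < n" "x < 2"
  shows "rail_diffs k b x i (diff2 (rail n x i)) (diffm (rail n x i))"
proof -
  \<comment> \<open>Position \<open>k + 1\<close> is a row of its own only for odd \<open>n\<close>;
    for even \<open>n\<close> it is the row \<open>i = k + b + 1\<close>.\<close>
  consider "i = 0" | "i = 1" | "2 \<le> i" "i \<le> k" | "b = 1" "i = k + 1" | "i = k + b + 1" | "k + b + 2 \<le> i"
    using n by linarith
  then show ?thesis
    using assms n m
    unfolding rail_diffs_def diff2_def diffm_def
      rail_rung_2[OF assms] rail_rung_m[OF assms] rail_rail[OF assms]
    by cases simp_all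
qed

lemma diff_rung:
  assumes "i < n"
  shows "rung_diffs k b i (diff2 (rung i)) (diffm (rung i))"
proof -
  consider "i = 0" | "i = 1" | "i = 2" | "3 \<le> i" "i \<le> k + b" | "i = k + b + 1" | "k + b + 2 \<le> i"
    by linarith
  then show ?thesis
    using assms n m
    unfolding rung_diffs_def diff2_def diffm_def
      rung_rung_2[OF assms] rung_rung_m[OF assms] rung_rail[OF assms]
    by cases auto
qed

lemma diff_inj:
  assumes "e \<in> edges (prism n)" "f \<in> edges (prism n)" and eq: "diff2 e = diff2 f" "diffm e = diffm f"
  shows "e = f"
proof -
  consider (rails) x i y j where "e = rail n x i" "f = rail n y j" "i < n" "x < 2" "j < n" "y < 2"
    | (rail_rung) x i j where "e = rail n x i" "f = rung j" "i < n" "x < 2" "j < n"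
    | (rung_rail) x i j where "f = rail n x i" "e = rung j" "i < n" "x < 2" "j < n"
    | (rungs) i j where "e = rung i" "f = rung j" "i < n" "j < n"
    using assms(1,2) unfolding edges_prism by blast
  then show ?thesis
  proof cases
    case rails
    have "rail_diffs k b x i (diff2 e) (diffm e)" "rail_diffs k b y j (diff2 e) (diffm e)"
      using diff_rail[of i x] diff_rail[of j y] eq rails by simp_all
    then have "x = y \<and> i = j"
      by (rule rail_diffs_inj) (use n rails in simp_all)
    with rails show ?thesis by simp
  next
    case rail_rung
    have eq': "diff2 (rail n x i) = diff2 (rung j)" "diffm (rail n x i) = diffm (rung j)"
      using eq rail_rung by simp_all
    have False
      by (rule rail_rung_diffs_disjoint[OF diff_rail diff_rung eq' _ n(2,3)])
        (use rail_rung n(1) in simp_all)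
    then show ?thesis ..
  next
    case rung_rail
    have eq': "diff2 (rail n x i) = diff2 (rung j)" "diffm (rail n x i) = diffm (rung j)"
      using eq rung_rail by simp_all
    have False
      by (rule rail_rung_diffs_disjoint[OF diff_rail diff_rung eq' _ n(2,3)])
        (use rung_rail n(1) in simp_all)
    then show ?thesis ..
  next
    case rungs
    have "rung_diffs k b i (diff2 e) (diffm e)" "rung_diffs k b j (diff2 e) (diffm e)"
      using diff_rung[of i] diff_rung[of j] eq rungs by simp_all
    then have "i = j"
      by (rule rung_diffs_inj) (use n rungs in simp_all)
    with rungs show ?thesis by simp
  qed
qed

end

section \<open>The three landmarks attain the lower bound\<close>

theorem theorem3p3:
  fixes n :: nat
  assumes "n \<ge> 6"
  shows "psi_E (prism n) = 3"
proof -
  \<comment> \<open>In these terms \<open>k + b + 1\<close> equals \<open>(n + 3) div 2\<close>, and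
    \<open>n \<ge> 6\<close> becomes \<open>k \<ge> 3\<close>.\<close>
  define k b where "k = n div 2" and "b = n mod 2"
  have kb: "n = 2 * k + b" "b \<le> 1" "k \<ge> 3" using assms by (auto simp: k_def b_def)
  define D where "D = {rail n 0 0, rung 2, rung (k + b + 1)}"
  have "card D = 3"
    using kb by (auto simp: D_def rail_def rung_def doubleton_eq_iff)
  have "D \<subseteq> edges (prism n)"
  proof -
    have "rail n 0 0 \<in> edges (prism n)" unfolding edges_prism using kb by fastforce
    moreover have "rung i \<in> edges (prism n)" if "i < n" for i using that by (auto simp: edges_prism)
    ultimately show ?thesis using kb by (simp add: D_def)
  qed
  moreover have "\<exists>x\<in>D. \<exists>y\<in>D. edge_doubly_resolve (prism n) x y e f"
    if "e \<in> edges (prism n)" "f \<in> edges (prism n)" "e \<noteq> f" for e f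
    \<comment> \<open>By contraposition, distinct edges differ in \<open>diff2\<close> or in
      \<open>diffm\<close>, which names the resolving pair.\<close>
    using diff_inj[OF kb refl that(1,2)] that(3)
    unfolding edge_doubly_resolve_def D_def diff2_def[OF kb refl] diffm_def[OF kb refl] by blast
  ultimately have "edge_doubly_resolving_set (prism n) D"
    unfolding edge_doubly_resolving_set_def by blast
  moreover have "finite D" by (simp add: D_def)
  ultimately show ?thesis
    unfolding psi_E_def
    using \<open>card D = 3\<close> card_edge_doubly_resolving_set_prism[OF assms] by (intro Least_equality) blast+
qed

end
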